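(* Let $\mathcal{C}$ and $\mathcal{C}'$ be categories and let $\mathcal{F}\colon \mathcal{C}\to\mathcal{C}'$ be a functor. If $\mathcal{F}$ is span tight, then $\mathrm{Span}(\mathcal{C},\mathcal{F})$, with the composition described in the context (which in particular is well defined on isomorphism classes of spans), is a category.
   Context: A span $S=(s_L,s_R)$ in a category is a pair of morphisms $s_L\colon S_A\to S_L$, $s_R\colon S_A\to S_R$ with the same source $S_A$. A cospan $C=(c_L,c_R)$ is a pair of morphisms $c_L\colon C_L\to C_A$, $c_R\colon C_R\to C_A$ with the same target. A span $S$ is paired with a cospan $C$ if $C_L=S_L$, $C_R=S_R$ and $c_L\circ s_L=c_R\circ s_R$. For spans $S,Q$ with $S_L=Q_L$ and $S_R=Q_R$, a span morphism from $S$ to $Q$ is a morphism $\Phi\colon S_A\to Q_A$ with $s_L=q_L\circ\Phi$ and $s_R=q_R\circ\Phi$; it is a span isomorphism if $\Phi$ is an isomorphism. $[S]$ denotes the span isomorphism class of $S$. A span $S$ is a pullback of a cospan $C$ if it is paired with $C$ and for every span $Q$ paired with $C$ there is a unique span morphism from $Q$ to $S$. For a functor $\mathcal{F}\colon\mathcal{C}\to\mathcal{C}'$, put $\mathcal{F}(S)=(\mathcal{F}(s_L),\mathcal{F}(s_R))$ and $\mathcal{F}(C)=(\mathcal{F}(c_L),\mathcal{F}(c_R))$. An $\mathcal{F}$-pullback of a cospan $C$ in $\mathcal{C}$ is a span $S$ in $\mathcal{C}$ paired with $C$ such that $\mathcal{F}(S)$ is a pullback of $\mathcal{F}(C)$ in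 $\mathcal{C}'$. $\mathcal{C}$ has $\mathcal{F}$-pullbacks in $\mathcal{C}'$ if every cospan in $\mathcal{C}$ has an $\mathcal{F}$-pullback. The functor $\mathcal{F}$ is span tight if $\mathcal{C}$ has $\mathcal{F}$-pullbacks in $\mathcal{C}'$ and, for any two $\mathcal{F}$-pullbacks $S$ and $Q$ of the same cospan, the unique span isomorphism from $\mathcal{F}(S)$ to $\mathcal{F}(Q)$ equals $\mathcal{F}(\Psi)$ for some span isomorphism $\Psi$ in $\mathcal{C}$ from $S$ to $Q$. For spans $S,Q$ in $\mathcal{C}$ with $S_R=Q_L$ and an $\mathcal{F}$-pullback $P$ of the cospan $(s_R,q_L)$, the $\mathcal{F}$-pullback composite of $S$ and $Q$ along $P$ is the span $S\circ_P Q=(s_L\circ p_L,\,q_R\circ p_R)$. $\mathrm{Span}(\mathcal{C},\mathcal{F})$: its objects are the objects of $\mathcal{C}$; its morphisms are the isomorphism classes $[S]$ of spans in $\mathcal{C}$, with source $S_R$ and target $S_L$; composition, for spans $S^1,S^2$ with $S^1_R=S^2_L$, is $[S^1]\circ[S^2]=[S^1\circ_P S^2]$, where $S^1\circ_P S^2$ is an $\mathcal{F}$-pullback composite of $S^1$ and $S^2$. The identity at an object $X$ is the class of $(\mathrm{Id}_X,\mathrm{Id}_X)$. *)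

theory Defs
  imports Main
begin

section \<open>Categories and functors\<close>

record ('o, 'm) cat =
  Ob :: "'o set"
  Ar :: "'m set"
  Dom :: "'m \<Rightarrow> 'o"
  Cod :: "'m \<Rightarrow> 'o"
  Ident :: "'o \<Rightarrow> 'm"
  Comp :: "'m \<Rightarrow> 'm \<Rightarrow> 'm" (infixl "\<cdot>\<index>" 70)

text \<open>Composition is written in the order of function composition and is only
  constrained on composable pairs of morphisms.\<close>

locale category =
  fixes C :: "('o, 'm) cat" (structure)
  assumes Dom_closed: "f \<in> Ar C \<Longrightarrow> Dom C f \<in> Ob C"
    and Cod_closed: "f \<in> Ar C \<Longrightarrow> Cod C f \<in> Ob C"
    and Ident_closed: "X \<in> Ob C \<Longrightarrow> Ident C X \<in> Ar C"
    and Dom_Ident: "X \<in> Ob C \<Longrightarrow> Dom C (Ident C X) = X"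
    and Cod_Ident: "X \<in> Ob C \<Longrightarrow> Cod C (Ident C X) = X"
    and Comp_closed: "\<lbrakk>f \<in> Ar C; g \<in> Ar C; Cod C f = Dom C g\<rbrakk> \<Longrightarrow> g \<cdot> f \<in> Ar C"
    and Dom_Comp: "\<lbrakk>f \<in> Ar C; g \<in> Ar C; Cod C f = Dom C g\<rbrakk> \<Longrightarrow> Dom C (g \<cdot> f) = Dom C f"
    and Cod_Comp: "\<lbrakk>f \<in> Ar C; g \<in> Ar C; Cod C f = Dom C g\<rbrakk> \<Longrightarrow> Cod C (g \<cdot> f) = Cod C g"
    and Comp_Ident_right: "f \<in> Ar C \<Longrightarrow> f \<cdot> Ident C (Dom C f) = f"
    and Comp_Ident_left: "f \<in> Ar C \<Longrightarrow> Ident C (Cod C f) \<cdot> f = f"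
    and Comp_assoc: "\<lbrakk>f \<in> Ar C; g \<in> Ar C; h \<in> Ar C; Cod C f = Dom C g; Cod C g = Dom C h\<rbrakk>
      \<Longrightarrow> (h \<cdot> g) \<cdot> f = h \<cdot> (g \<cdot> f)"

definition is_iso :: "('o, 'm) cat \<Rightarrow> 'm \<Rightarrow> bool" where
  "is_iso C f \<longleftrightarrow> f \<in> Ar C \<and>
    (\<exists>g \<in> Ar C. Dom C g = Cod C f \<and> Cod C g = Dom C f \<and>
      g \<cdot>\<^bsub>C\<^esub> f = Ident C (Dom C f) \<and> f \<cdot>\<^bsub>C\<^esub> g = Ident C (Cod C f))"

record ('o, 'm, 'p, 'n) fctr =
  on_ob :: "'o \<Rightarrow> 'p"
  on_ar :: "'m \<Rightarrow> 'n"

definition is_functor :: "('o, 'm) cat \<Rightarrow> ('p, 'n) cat \<Rightarrow> ('o, 'm, 'p, 'n) fctr \<Rightarrow> bool" where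
  "is_functor C C' F \<longleftrightarrow>
    (\<forall>X \<in> Ob C. on_ob F X \<in> Ob C' \<and> on_ar F (Ident C X) = Ident C' (on_ob F X)) \<and>
    (\<forall>f \<in> Ar C. on_ar F f \<in> Ar C' \<and>
      Dom C' (on_ar F f) = on_ob F (Dom C f) \<and> Cod C' (on_ar F f) = on_ob F (Cod C f)) \<and>
    (\<forall>f \<in> Ar C. \<forall>g \<in> Ar C. Cod C f = Dom C g \<longrightarrow>
      on_ar F (g \<cdot>\<^bsub>C\<^esub> f) = on_ar F g \<cdot>\<^bsub>C'\<^esub> on_ar F f)"

section \<open>Spans, cospans and pullbacks\<close>

datatype 'm span = Span (left: 'm) (right: 'm)
datatype 'm cospan = Cospan (coleft: 'm) (coright: 'm)

definition is_span :: "('o, 'm) cat \<Rightarrow> 'm span \<Rightarrow> bool" where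
  "is_span C S \<longleftrightarrow> left S \<in> Ar C \<and> right S \<in> Ar C \<and> Dom C (left S) = Dom C (right S)"

definition is_cospan :: "('o, 'm) cat \<Rightarrow> 'm cospan \<Rightarrow> bool" where
  "is_cospan C K \<longleftrightarrow> coleft K \<in> Ar C \<and> coright K \<in> Ar C \<and> Cod C (coleft K) = Cod C (coright K)"

definition apex :: "('o, 'm) cat \<Rightarrow> 'm span \<Rightarrow> 'o" where
  "apex C S = Dom C (left S)"

definition left_foot :: "('o, 'm) cat \<Rightarrow> 'm span \<Rightarrow> 'o" where
  "left_foot C S = Cod C (left S)"

definition right_foot :: "('o, 'm) cat \<Rightarrow> 'm span \<Rightarrow> 'o" where
  "right_foot C S = Cod C (right S)"

definition paired :: "('o, 'm) cat \<Rightarrow> 'm span \<Rightarrow> 'm cospan \<Rightarrow> bool" where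
  "paired C S K \<longleftrightarrow> is_span C S \<and> is_cospan C K \<and>
    Dom C (coleft K) = left_foot C S \<and> Dom C (coright K) = right_foot C S \<and>
    coleft K \<cdot>\<^bsub>C\<^esub> left S = coright K \<cdot>\<^bsub>C\<^esub> right S"

definition span_mor :: "('o, 'm) cat \<Rightarrow> 'm span \<Rightarrow> 'm span \<Rightarrow> 'm \<Rightarrow> bool" where
  "span_mor C S Q \<Phi> \<longleftrightarrow> is_span C S \<and> is_span C Q \<and>
    left_foot C S = left_foot C Q \<and> right_foot C S = right_foot C Q \<and>
    \<Phi> \<in> Ar C \<and> Dom C \<Phi> = apex C S \<and> Cod C \<Phi> = apex C Q \<and>
    left S = left Q \<cdot>\<^bsub>C\<^esub> \<Phi> \<and> right S = right Q \<cdot>\<^bsub>C\<^esub> \<Phi>"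

definition span_iso :: "('o, 'm) cat \<Rightarrow> 'm span \<Rightarrow> 'm span \<Rightarrow> 'm \<Rightarrow> bool" where
  "span_iso C S Q \<Phi> \<longleftrightarrow> span_mor C S Q \<Phi> \<and> is_iso C \<Phi>"

definition span_class :: "('o, 'm) cat \<Rightarrow> 'm span \<Rightarrow> 'm span set" where
  "span_class C S = {Q. \<exists>\<Phi>. span_iso C S Q \<Phi>}"

definition is_pullback :: "('o, 'm) cat \<Rightarrow> 'm span \<Rightarrow> 'm cospan \<Rightarrow> bool" where
  "is_pullback C S K \<longleftrightarrow> paired C S K \<and> (\<forall>Q. paired C Q K \<longrightarrow> (\<exists>!\<Phi>. span_mor C Q S \<Phi>))"

section \<open>Pullbacks relative to a functor\<close>

definition fspan :: "('o, 'm, 'p, 'n) fctr \<Rightarrow> 'm span \<Rightarrow> 'n span" where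
  "fspan F S = Span (on_ar F (left S)) (on_ar F (right S))"

definition fcospan :: "('o, 'm, 'p, 'n) fctr \<Rightarrow> 'm cospan \<Rightarrow> 'n cospan" where
  "fcospan F K = Cospan (on_ar F (coleft K)) (on_ar F (coright K))"

definition is_F_pullback ::
  "('o, 'm) cat \<Rightarrow> ('p, 'n) cat \<Rightarrow> ('o, 'm, 'p, 'n) fctr \<Rightarrow> 'm span \<Rightarrow> 'm cospan \<Rightarrow> bool" where
  "is_F_pullback C C' F S K \<longleftrightarrow> paired C S K \<and> is_pullback C' (fspan F S) (fcospan F K)"

definition has_F_pullbacks ::
  "('o, 'm) cat \<Rightarrow> ('p, 'n) cat \<Rightarrow> ('o, 'm, 'p, 'n) fctr \<Rightarrow> bool" where
  "has_F_pullbacks C C' F \<longleftrightarrow> (\<forall>K. is_cospan C K \<longrightarrow> (\<exists>S. is_F_pullback C C' F S K))"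

text \<open>The definite description below denotes the comparison isomorphism between the
  pullbacks \<open>F S\<close> and \<open>F Q\<close> of \<open>F K\<close> in \<open>C'\<close>, which exists and is
  unique whenever the premises hold.\<close>

definition span_tight ::
  "('o, 'm) cat \<Rightarrow> ('p, 'n) cat \<Rightarrow> ('o, 'm, 'p, 'n) fctr \<Rightarrow> bool" where
  "span_tight C C' F \<longleftrightarrow> has_F_pullbacks C C' F \<and>
    (\<forall>K S Q. is_F_pullback C C' F S K \<and> is_F_pullback C C' F Q K \<longrightarrow>
      (\<exists>\<Psi>. span_iso C S Q \<Psi> \<and> (THE \<Phi>. span_iso C' (fspan F S) (fspan F Q) \<Phi>) = on_ar F \<Psi>))"

section \<open>The span category\<close>

definition span_comp :: "('o, 'm) cat \<Rightarrow> 'm span \<Rightarrow> 'm span \<Rightarrow> 'm span \<Rightarrow> 'm span" where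
  "span_comp C S P Q = Span (left S \<cdot>\<^bsub>C\<^esub> left P) (right Q \<cdot>\<^bsub>C\<^esub> right P)"

text \<open>Source, target and composite of isomorphism classes are given by definite descriptions
  over representatives. A span goes from its right foot to its left foot.\<close>

definition Span_cat ::
  "('o, 'm) cat \<Rightarrow> ('p, 'n) cat \<Rightarrow> ('o, 'm, 'p, 'n) fctr \<Rightarrow> ('o, 'm span set) cat" where
  "Span_cat C C' F = \<lparr>
    Ob = Ob C,
    Ar = {span_class C S |S. is_span C S},
    Dom = (\<lambda>a. THE X. \<exists>S. is_span C S \<and> a = span_class C S \<and> X = right_foot C S),
    Cod = (\<lambda>a. THE X. \<exists>S. is_span C S \<and> a = span_class C S \<and> X = left_foot C S),
    Ident = (\<lambda>X. span_class C (Span (Ident C X) (Ident C X))),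
    Comp = (\<lambda>a b. THE c. \<exists>S Q P. is_span C S \<and> is_span C Q \<and>
      a = span_class C S \<and> b = span_class C Q \<and> right_foot C S = left_foot C Q \<and>
      is_F_pullback C C' F P (Cospan (right S) (left Q)) \<and>
      c = span_class C (span_comp C S P Q))\<rparr>"

end

theory Submission
  imports Defs
begin

text \<open>
  Call a commutative square in \<open>C\<close> an F-square if \<open>F\<close> sends it to a pullback. Three closure
  properties of ordinary pullback squares pass to F-squares, because functors preserve
  commutative squares, composites, identities and isomorphisms: squares with two parallel identity
  sides are pullbacks (\<open>F_pullback_Ident\<close>), a pullback may be transported along isomorphisms of the
  two outer objects of its cospan (\<open>F_pullback_transport\<close>), and two adjacent pullbacks paste to a
  pullback (\<open>F_pullback_pasting\<close>).

  What does not pass from \<open>C'\<close> to \<open>C\<close> is the universal property, and hence the uniqueness of a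
  pullback. Span tightness restores it: any two F-pullbacks of a cospan are isomorphic as spans
  in \<open>C\<close> (\<open>F_pullback_unique\<close>). The composite of two spans is thus independent, up to isomorphism,
  of the F-pullback chosen, and the three closure properties then become the laws of the span
  category. Transport makes composition a function of isomorphism classes; the identity squares
  provide F-pullbacks along which composition with an identity span gives back the given span; and
  pasting shows that both bracketings of a triple composite can be computed along one common
  diagram, a pyramid of three F-squares, where they agree on the nose by associativity in \<open>C\<close>.
\<close>

section \<open>Pullback squares in a category\<close>

lemma paired_Span_iff:
  "paired C (Span a b) (Cospan f g) \<longleftrightarrow>
    a \<in> Ar C \<and> b \<in> Ar C \<and> f \<in> Ar C \<and> g \<in> Ar C \<and> Dom C a = Dom C b \<and> Cod C f = Cod C g \<and>
    Dom C f = Cod C a \<and> Dom C g = Cod C b \<and> f \<cdot>\<^bsub>C\<^esub> a = g \<cdot>\<^bsub>C\<^esub> b"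
  by (auto simp: paired_def is_span_def is_cospan_def left_foot_def right_foot_def)

text \<open>The universal property is split into existence of the mediating morphism and joint
  monicity of the two projections. This keeps the arguments below at the level of equations between
  composites, without a span around every pair of morphisms.\<close>

lemma pullback_factor:
  assumes "is_pullback C (Span a b) (Cospan f g)"
    and "x \<in> Ar C" "y \<in> Ar C" "Dom C x = Dom C y" "Cod C x = Dom C f" "Cod C y = Dom C g"
    and "f \<cdot>\<^bsub>C\<^esub> x = g \<cdot>\<^bsub>C\<^esub> y"
  obtains u where "u \<in> Ar C" "Dom C u = Dom C x" "Cod C u = Dom C a"
    "a \<cdot>\<^bsub>C\<^esub> u = x" "b \<cdot>\<^bsub>C\<^esub> u = y"
proof -
  have "paired C (Span a b) (Cospan f g)"
    using assms(1) by (simp add: is_pullback_def)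
  then have "paired C (Span x y) (Cospan f g)"
    using assms(2-) by (simp add: paired_Span_iff)
  then obtain u where "span_mor C (Span x y) (Span a b) u"
    using assms(1) by (auto simp: is_pullback_def)
  then show thesis
    by (intro that[of u]) (auto simp: span_mor_def apex_def)
qed

lemma (in category) pullback_jointly_monic:
  assumes pb: "is_pullback C (Span a b) (Cospan f g)"
    and u: "u \<in> Ar C" "Cod C u = Dom C a" and v: "v \<in> Ar C" "Cod C v = Dom C a"
    and dom: "Dom C u = Dom C v"
    and eq: "a \<cdot> u = a \<cdot> v" "b \<cdot> u = b \<cdot> v"
  shows "u = v"
proof -
  have P: "paired C (Span a b) (Cospan f g)"
    using pb by (simp add: is_pullback_def)
  then have mor: "span_mor C (Span (a \<cdot> u) (b \<cdot> u)) (Span a b) w"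
    if "w \<in> Ar C" "Dom C w = Dom C u" "Cod C w = Dom C a" "a \<cdot> u = a \<cdot> w" "b \<cdot> u = b \<cdot> w" for w
    using that u
    by (auto simp: paired_Span_iff span_mor_def is_span_def left_foot_def right_foot_def apex_def
        Comp_closed Dom_Comp Cod_Comp)
  have "paired C (Span (a \<cdot> u) (b \<cdot> u)) (Cospan f g)"
    using P u by (auto simp: paired_Span_iff Comp_closed Dom_Comp Cod_Comp simp flip: Comp_assoc)
  then have "\<exists>!w. span_mor C (Span (a \<cdot> u) (b \<cdot> u)) (Span a b) w"
    using pb unfolding is_pullback_def by blast
  then show ?thesis
    using mor[of u] mor[of v] u v dom eq by auto
qed

lemma is_pullbackI:
  assumes P: "paired C (Span a b) (Cospan f g)"
    and ex: "\<And>x y. \<lbrakk>x \<in> Ar C; y \<in> Ar C; Dom C x = Dom C y; Cod C x = Dom C f; Cod C y = Dom C g;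
      f \<cdot>\<^bsub>C\<^esub> x = g \<cdot>\<^bsub>C\<^esub> y\<rbrakk> \<Longrightarrow>
      \<exists>u \<in> Ar C. Dom C u = Dom C x \<and> Cod C u = Dom C a \<and> a \<cdot>\<^bsub>C\<^esub> u = x \<and> b \<cdot>\<^bsub>C\<^esub> u = y"
    and unique: "\<And>u v. \<lbrakk>u \<in> Ar C; v \<in> Ar C; Dom C u = Dom C v; Cod C u = Dom C a; Cod C v = Dom C a;
      a \<cdot>\<^bsub>C\<^esub> u = a \<cdot>\<^bsub>C\<^esub> v; b \<cdot>\<^bsub>C\<^esub> u = b \<cdot>\<^bsub>C\<^esub> v\<rbrakk> \<Longrightarrow> u = v"
  shows "is_pullback C (Span a b) (Cospan f g)"
  unfolding is_pullback_def
proof (intro conjI P allI impI)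
  fix Q assume Q: "paired C Q (Cospan f g)"
  obtain x y where xy: "Q = Span x y" by (cases Q)
  obtain u where u: "u \<in> Ar C" "Dom C u = Dom C x" "Cod C u = Dom C a"
    "a \<cdot>\<^bsub>C\<^esub> u = x" "b \<cdot>\<^bsub>C\<^esub> u = y"
    using ex[of x y] Q unfolding xy paired_Span_iff by metis
  show "\<exists>!\<Phi>. span_mor C Q (Span a b) \<Phi>"
  proof (rule ex1I[of _ u])
    show "span_mor C Q (Span a b) u"
      using P Q u unfolding xy paired_Span_iff
      by (auto simp: span_mor_def is_span_def left_foot_def right_foot_def apex_def)
  next
    fix v assume "span_mor C Q (Span a b) v"
    then have v: "v \<in> Ar C" "Dom C v = Dom C x" "Cod C v = Dom C a"
      "a \<cdot>\<^bsub>C\<^esub> v = x" "b \<cdot>\<^bsub>C\<^esub> v = y"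
      by (simp_all add: xy span_mor_def apex_def)
    show "v = u"
      by (rule unique) (simp_all add: u v)
  qed
qed

lemma paired_swap:
  "paired C (Span a b) (Cospan f g) \<Longrightarrow> paired C (Span b a) (Cospan g f)"
  by (simp add: paired_Span_iff)

lemma (in category) pullback_swap:
  assumes pb: "is_pullback C (Span a b) (Cospan f g)"
  shows "is_pullback C (Span b a) (Cospan g f)"
proof (rule is_pullbackI)
  have P: "paired C (Span a b) (Cospan f g)"
    using pb by (simp add: is_pullback_def)
  then show "paired C (Span b a) (Cospan g f)"
    by (rule paired_swap)
  have dom: "Dom C b = Dom C a"
    using P by (simp add: paired_Span_iff)
  show "\<exists>u \<in> Ar C. Dom C u = Dom C x \<and> Cod C u = Dom C b \<and> b \<cdot> u = x \<and> a \<cdot> u = y"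
    if "x \<in> Ar C" "y \<in> Ar C" "Dom C x = Dom C y" "Cod C x = Dom C g" "Cod C y = Dom C f"
      "g \<cdot> x = f \<cdot> y" for x y
    by (rule pullback_factor[OF pb, of y x]) (use that dom in auto)
  show "u = v"
    if "u \<in> Ar C" "v \<in> Ar C" "Dom C u = Dom C v" "Cod C u = Dom C b" "Cod C v = Dom C b"
      "b \<cdot> u = b \<cdot> v" "a \<cdot> u = a \<cdot> v" for u v
    using pullback_jointly_monic[OF pb, of u v] that dom by simp
qed

text \<open>Commutativity of the composite squares is recorded apart from their universal property,
  because an F-pullback is a commutative square in \<open>C\<close> but a pullback only in \<open>C'\<close>.\<close>

lemma (in category) paired_pasting:
  assumes "paired C (Span u v) (Cospan f g)" "paired C (Span a b) (Cospan h u)"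
    and "Cod C h = Dom C f"
  shows "paired C (Span a (v \<cdot> b)) (Cospan (f \<cdot> h) g)"
proof -
  note P = assms[unfolded paired_Span_iff]
  have "(f \<cdot> h) \<cdot> a = f \<cdot> (u \<cdot> b)"
    using P by (simp add: Comp_assoc)
  also have "\<dots> = (g \<cdot> v) \<cdot> b"
    using P by (simp flip: Comp_assoc)
  also have "\<dots> = g \<cdot> (v \<cdot> b)"
    using P by (simp add: Comp_assoc)
  finally show ?thesis
    using P by (simp add: paired_Span_iff Comp_closed Dom_Comp Cod_Comp)
qed

text \<open>A cone over the outer cospan is first factored through the square \<open>(u, v)\<close>, which turns
  it into a cone over the cospan \<open>(h, u)\<close>.\<close>

lemma (in category) pullback_pasting:
  assumes pb1: "is_pullback C (Span u v) (Cospan f g)"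
    and pb2: "is_pullback C (Span a b) (Cospan h u)"
    and cod: "Cod C h = Dom C f"
  shows "is_pullback C (Span a (v \<cdot> b)) (Cospan (f \<cdot> h) g)"
proof (rule is_pullbackI)
  have P1: "paired C (Span u v) (Cospan f g)" and P2: "paired C (Span a b) (Cospan h u)"
    using pb1 pb2 by (simp_all add: is_pullback_def)
  then show "paired C (Span a (v \<cdot> b)) (Cospan (f \<cdot> h) g)"
    using cod by (rule paired_pasting)
  note P = P1[unfolded paired_Span_iff] P2[unfolded paired_Span_iff]
  show "\<exists>w \<in> Ar C. Dom C w = Dom C x \<and> Cod C w = Dom C a \<and> a \<cdot> w = x \<and> (v \<cdot> b) \<cdot> w = y"
    if xy: "x \<in> Ar C" "y \<in> Ar C" "Dom C x = Dom C y" "Cod C x = Dom C (f \<cdot> h)" "Cod C y = Dom C g"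
      "(f \<cdot> h) \<cdot> x = g \<cdot> y" for x y
  proof -
    have x: "Cod C x = Dom C h"
      using xy P cod by (simp add: Dom_Comp)
    have fhx: "f \<cdot> (h \<cdot> x) = g \<cdot> y"
      using xy P cod x by (simp add: Comp_assoc)
    obtain z where z: "z \<in> Ar C" "Dom C z = Dom C x" "Cod C z = Dom C u"
      "u \<cdot> z = h \<cdot> x" "v \<cdot> z = y"
      by (rule pullback_factor[OF pb1, of "h \<cdot> x" y])
        (use xy P cod x fhx in \<open>auto simp: Comp_closed Dom_Comp Cod_Comp\<close>)
    obtain w where w: "w \<in> Ar C" "Dom C w = Dom C x" "Cod C w = Dom C a" "a \<cdot> w = x" "b \<cdot> w = z"
      by (rule pullback_factor[OF pb2, of x z]) (use xy P x z in auto)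
    have "(v \<cdot> b) \<cdot> w = y"
      using w z P by (simp add: Comp_assoc)
    with w show ?thesis by auto
  qed
  show "w = w'"
    if w: "w \<in> Ar C" "w' \<in> Ar C" "Dom C w = Dom C w'" "Cod C w = Dom C a" "Cod C w' = Dom C a"
      "a \<cdot> w = a \<cdot> w'" "(v \<cdot> b) \<cdot> w = (v \<cdot> b) \<cdot> w'" for w w'
  proof -
    have "u \<cdot> (b \<cdot> t) = h \<cdot> (a \<cdot> t)" if "t \<in> Ar C" "Cod C t = Dom C a" for t
      using that P by (simp flip: Comp_assoc)
    then have "u \<cdot> (b \<cdot> w) = u \<cdot> (b \<cdot> w')"
      using w by metis
    moreover have "v \<cdot> (b \<cdot> w) = v \<cdot> (b \<cdot> w')"
      using w P by (simp add: Comp_assoc)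
    ultimately have "b \<cdot> w = b \<cdot> w'"
      using pullback_jointly_monic[OF pb1, of "b \<cdot> w" "b \<cdot> w'"] w P
      by (simp add: Comp_closed Dom_Comp Cod_Comp)
    then show ?thesis
      using pullback_jointly_monic[OF pb2, of w w'] w by simp
  qed
qed

lemma (in category) paired_transport:
  assumes "paired C (Span a b) (Cospan (f \<cdot> i) (g \<cdot> j))"
    and "f \<in> Ar C" "i \<in> Ar C" "Cod C i = Dom C f" "g \<in> Ar C" "j \<in> Ar C" "Cod C j = Dom C g"
  shows "paired C (Span (i \<cdot> a) (j \<cdot> b)) (Cospan f g)"
  using assms unfolding paired_Span_iff
  by (auto simp: Comp_closed Dom_Comp Cod_Comp Comp_assoc)

lemma is_isoE:
  assumes "is_iso C f"
  obtains g where "g \<in> Ar C" "Dom C g = Cod C f" "Cod C g = Dom C f"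
    "g \<cdot>\<^bsub>C\<^esub> f = Ident C (Dom C f)" "f \<cdot>\<^bsub>C\<^esub> g = Ident C (Cod C f)"
  using assms by (auto simp: is_iso_def)

lemma (in category) iso_cancel_left:
  assumes i: "is_iso C i" "i \<in> Ar C"
    and "x \<in> Ar C" "y \<in> Ar C" "Cod C x = Dom C i" "Cod C y = Dom C i" "i \<cdot> x = i \<cdot> y"
  shows "x = y"
proof -
  obtain k where "k \<in> Ar C" "Dom C k = Cod C i" "k \<cdot> i = Ident C (Dom C i)"
    using i(1) by (rule is_isoE)
  then show ?thesis
    using assms by (metis Comp_assoc Comp_Ident_left)
qed

lemma (in category) iso_factor:
  assumes i: "is_iso C i" "i \<in> Ar C" and x: "x \<in> Ar C" "Cod C x = Cod C i"
  obtains x' where "x' \<in> Ar C" "Dom C x' = Dom C x" "Cod C x' = Dom C i" "i \<cdot> x' = x"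
proof -
  obtain k where k: "k \<in> Ar C" "Dom C k = Cod C i" "Cod C k = Dom C i" "i \<cdot> k = Ident C (Cod C i)"
    using i(1) by (rule is_isoE)
  show thesis
  proof (rule that[of "k \<cdot> x"])
    show "i \<cdot> (k \<cdot> x) = x"
      using i x k by (metis Comp_assoc Comp_Ident_left)
  qed (use i x k in \<open>simp_all add: Comp_closed Dom_Comp Cod_Comp\<close>)
qed

text \<open>Since \<open>i\<close> and \<open>j\<close> are invertible, each cone over \<open>(f, g)\<close> comes from exactly one cone over
  \<open>(f i, g j)\<close>.\<close>

lemma (in category) pullback_transport:
  assumes pb: "is_pullback C (Span a b) (Cospan (f \<cdot> i) (g \<cdot> j))"
    and ar: "f \<in> Ar C" "i \<in> Ar C" "Cod C i = Dom C f" "g \<in> Ar C" "j \<in> Ar C" "Cod C j = Dom C g"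
    and iso: "is_iso C i" "is_iso C j"
  shows "is_pullback C (Span (i \<cdot> a) (j \<cdot> b)) (Cospan f g)"
proof (rule is_pullbackI)
  have P: "paired C (Span a b) (Cospan (f \<cdot> i) (g \<cdot> j))"
    using pb by (simp add: is_pullback_def)
  then show "paired C (Span (i \<cdot> a) (j \<cdot> b)) (Cospan f g)"
    using ar by (rule paired_transport)
  have P': "a \<in> Ar C" "b \<in> Ar C" "Dom C a = Dom C b" "Cod C a = Dom C i" "Cod C b = Dom C j"
    using P ar by (auto simp: paired_Span_iff Dom_Comp)
  have dom: "Dom C (i \<cdot> a) = Dom C a"
    using P' ar by (simp add: Dom_Comp)
  show "\<exists>u \<in> Ar C. Dom C u = Dom C x \<and> Cod C u = Dom C (i \<cdot> a) \<and>
      (i \<cdot> a) \<cdot> u = x \<and> (j \<cdot> b) \<cdot> u = y"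
    if xy: "x \<in> Ar C" "y \<in> Ar C" "Dom C x = Dom C y" "Cod C x = Dom C f" "Cod C y = Dom C g"
      "f \<cdot> x = g \<cdot> y" for x y
  proof -
    obtain x' where x': "x' \<in> Ar C" "Dom C x' = Dom C x" "Cod C x' = Dom C i" "i \<cdot> x' = x"
      by (rule iso_factor[OF iso(1) ar(2), of x]) (use xy ar in auto)
    obtain y' where y': "y' \<in> Ar C" "Dom C y' = Dom C y" "Cod C y' = Dom C j" "j \<cdot> y' = y"
      by (rule iso_factor[OF iso(2) ar(5), of y]) (use xy ar in auto)
    have eq: "(f \<cdot> i) \<cdot> x' = (g \<cdot> j) \<cdot> y'"
      using ar x' y' xy by (simp add: Comp_assoc)
    obtain u where u: "u \<in> Ar C" "Dom C u = Dom C x'" "Cod C u = Dom C a" "a \<cdot> u = x'" "b \<cdot> u = y'"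
      by (rule pullback_factor[OF pb, of x' y']) (use x' y' xy ar eq in \<open>auto simp: Dom_Comp\<close>)
    then have "(i \<cdot> a) \<cdot> u = x" "(j \<cdot> b) \<cdot> u = y"
      using P' ar x' y' by (simp_all add: Comp_assoc)
    with u show ?thesis using dom x' by auto
  qed
  show "u = v"
    if uv: "u \<in> Ar C" "v \<in> Ar C" "Dom C u = Dom C v" "Cod C u = Dom C (i \<cdot> a)"
      "Cod C v = Dom C (i \<cdot> a)" "(i \<cdot> a) \<cdot> u = (i \<cdot> a) \<cdot> v" "(j \<cdot> b) \<cdot> u = (j \<cdot> b) \<cdot> v" for u v
  proof -
    note uv' = uv[unfolded dom]
    have "a \<cdot> u = a \<cdot> v"
      using iso_cancel_left[OF iso(1) ar(2), of "a \<cdot> u" "a \<cdot> v"] uv' P' ar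
      by (simp add: Comp_assoc Comp_closed Cod_Comp)
    moreover have "b \<cdot> u = b \<cdot> v"
      using iso_cancel_left[OF iso(2) ar(5), of "b \<cdot> u" "b \<cdot> v"] uv' P' ar
      by (simp add: Comp_assoc Comp_closed Cod_Comp)
    ultimately show ?thesis
      using pullback_jointly_monic[OF pb, of u v] uv' by simp
  qed
qed

lemma (in category) paired_Ident:
  "f \<in> Ar C \<Longrightarrow> paired C (Span (Ident C (Dom C f)) f) (Cospan f (Ident C (Cod C f)))"
  by (simp add: paired_Span_iff Ident_closed Dom_Ident Cod_Ident Dom_closed Cod_closed
      Comp_Ident_left Comp_Ident_right)

lemma (in category) pullback_Ident:
  assumes f: "f \<in> Ar C"
  shows "is_pullback C (Span (Ident C (Dom C f)) f) (Cospan f (Ident C (Cod C f)))"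
proof (rule is_pullbackI)
  note ids = Ident_closed Dom_Ident Cod_Ident Dom_closed Cod_closed
  show "paired C (Span (Ident C (Dom C f)) f) (Cospan f (Ident C (Cod C f)))"
    using f by (rule paired_Ident)
  show "\<exists>u \<in> Ar C. Dom C u = Dom C x \<and> Cod C u = Dom C (Ident C (Dom C f)) \<and>
      Ident C (Dom C f) \<cdot> u = x \<and> f \<cdot> u = y"
    if "x \<in> Ar C" "y \<in> Ar C" "Dom C x = Dom C y" "Cod C x = Dom C f"
      "Cod C y = Dom C (Ident C (Cod C f))" "f \<cdot> x = Ident C (Cod C f) \<cdot> y" for x y
    using that f by (intro bexI[of _ x]) (simp_all add: ids, metis Comp_Ident_left)+
  show "u = v"
    if "u \<in> Ar C" "v \<in> Ar C" "Cod C u = Dom C (Ident C (Dom C f))"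
      "Cod C v = Dom C (Ident C (Dom C f))"
      "Ident C (Dom C f) \<cdot> u = Ident C (Dom C f) \<cdot> v" for u v
    using that f by (simp add: ids) (metis Comp_Ident_left)
qed

section \<open>Isomorphism of spans\<close>

context category
begin

lemma is_iso_Ident: "X \<in> Ob C \<Longrightarrow> is_iso C (Ident C X)"
  unfolding is_iso_def
  by (metis Ident_closed Dom_Ident Cod_Ident Comp_Ident_left)

lemma is_iso_Comp:
  assumes f: "is_iso C f" and g: "is_iso C g" and fg: "Cod C f = Dom C g"
  shows "is_iso C (g \<cdot> f)"
proof -
  have ar: "f \<in> Ar C" "g \<in> Ar C"
    using f g by (auto simp: is_iso_def)
  obtain f' where f': "f' \<in> Ar C" "Dom C f' = Cod C f" "Cod C f' = Dom C f"
    "f' \<cdot> f = Ident C (Dom C f)" "f \<cdot> f' = Ident C (Cod C f)"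
    using f by (rule is_isoE)
  obtain g' where g': "g' \<in> Ar C" "Dom C g' = Cod C g" "Cod C g' = Dom C g"
    "g' \<cdot> g = Ident C (Dom C g)" "g \<cdot> g' = Ident C (Cod C g)"
    using g by (rule is_isoE)
  have "g' \<cdot> (g \<cdot> f) = f" "f \<cdot> (f' \<cdot> g') = g'"
    using ar fg f' g' by (metis Comp_assoc Comp_Ident_left)+
  then have 1: "(f' \<cdot> g') \<cdot> (g \<cdot> f) = Ident C (Dom C (g \<cdot> f))"
    and 2: "(g \<cdot> f) \<cdot> (f' \<cdot> g') = Ident C (Cod C (g \<cdot> f))"
    using ar fg f' g' by (simp_all add: Comp_assoc Comp_closed Dom_Comp Cod_Comp)
  show ?thesis
    unfolding is_iso_def using 1 2 ar fg f' g'
    by (intro conjI bexI[of _ "f' \<cdot> g'"]) (simp_all add: Comp_closed Dom_Comp Cod_Comp)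
qed

lemma span_iso_refl: "is_span C S \<Longrightarrow> span_iso C S S (Ident C (apex C S))"
  by (auto simp: span_iso_def span_mor_def is_span_def apex_def is_iso_Ident Dom_closed
      Ident_closed Dom_Ident Cod_Ident Comp_Ident_right) (metis Comp_Ident_right)

lemma span_iso_sym:
  assumes "span_iso C S Q i"
  obtains k where "span_iso C Q S k"
proof -
  have i: "is_iso C i" and mor: "span_mor C S Q i"
    using assms by (auto simp: span_iso_def)
  obtain k where k: "k \<in> Ar C" "Dom C k = Cod C i" "Cod C k = Dom C i"
    "k \<cdot> i = Ident C (Dom C i)" "i \<cdot> k = Ident C (Cod C i)"
    using i by (rule is_isoE)
  have "is_iso C k"
    using k mor unfolding is_iso_def span_mor_def by metis
  moreover have "left S \<cdot> k = left Q" "right S \<cdot> k = right Q"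
    using mor k by (auto simp: span_mor_def is_span_def apex_def Comp_assoc)
      (metis Comp_Ident_right)+
  ultimately have "span_iso C Q S k"
    using mor k by (auto simp: span_iso_def span_mor_def)
  then show thesis by (rule that)
qed

lemma span_iso_trans:
  assumes "span_iso C S Q i" "span_iso C Q T j"
  shows "span_iso C S T (j \<cdot> i)"
proof -
  note ij = assms[unfolded span_iso_def span_mor_def is_span_def apex_def]
  have "left S = left T \<cdot> (j \<cdot> i)" "right S = right T \<cdot> (j \<cdot> i)"
    using ij by (metis Comp_assoc)+
  moreover have "is_iso C (j \<cdot> i)" "j \<cdot> i \<in> Ar C" "Dom C (j \<cdot> i) = Dom C i" "Cod C (j \<cdot> i) = Cod C j"
    using ij by (metis is_iso_Comp Comp_closed Dom_Comp Cod_Comp)+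
  ultimately show ?thesis
    unfolding span_iso_def span_mor_def is_span_def apex_def using ij by (intro conjI) metis+
qed

lemma span_class_eq_iff:
  assumes S: "is_span C S" and Q: "is_span C Q"
  shows "span_class C S = span_class C Q \<longleftrightarrow> (\<exists>i. span_iso C S Q i)"
proof
  assume "span_class C S = span_class C Q"
  then show "\<exists>i. span_iso C S Q i"
    using span_iso_refl[OF Q] by (auto simp: span_class_def)
next
  assume "\<exists>i. span_iso C S Q i"
  then obtain i k where "span_iso C S Q i" "span_iso C Q S k"
    by (metis span_iso_sym)
  then show "span_class C S = span_class C Q"
    unfolding span_class_def using span_iso_trans by blast
qed

lemma span_class_eq_feet:
  assumes "is_span C S" "is_span C Q" "span_class C S = span_class C Q"
  shows "left_foot C S = left_foot C Q" "right_foot C S = right_foot C Q"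
  using assms by (auto simp: span_class_eq_iff span_iso_def span_mor_def)

lemma is_span_span_comp:
  assumes "is_span C S" "is_span C Q" "paired C P (Cospan (right S) (left Q))"
  shows "is_span C (span_comp C S P Q)"
    and "left_foot C (span_comp C S P Q) = left_foot C S"
    and "right_foot C (span_comp C S P Q) = right_foot C Q"
  using assms
  by (auto simp: span_comp_def is_span_def paired_def left_foot_def right_foot_def
      Comp_closed Dom_Comp Cod_Comp)

lemma span_comp_iso_apex:
  assumes S: "is_span C S" and Q: "is_span C Q"
    and P: "paired C P (Cospan (right S) (left Q))" and P': "paired C P' (Cospan (right S) (left Q))"
    and i: "span_iso C P P' i"
  shows "span_iso C (span_comp C S P Q) (span_comp C S P' Q) i"
proof -
  note SQ = S[unfolded is_span_def] Q[unfolded is_span_def]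
  have ar: "left P \<in> Ar C" "Cod C (left P) = Dom C (left S)"
      "right P \<in> Ar C" "Cod C (right P) = Dom C (right Q)"
      "left P' \<in> Ar C" "Cod C (left P') = Dom C (left S)"
      "right P' \<in> Ar C" "Cod C (right P') = Dom C (right Q)"
    using P P' SQ by (auto simp: paired_def is_span_def left_foot_def right_foot_def)
  have i': "i \<in> Ar C" "is_iso C i" "Dom C i = Dom C (left P)"
      "Cod C i = Dom C (left P')" "Cod C i = Dom C (right P')"
    using i by (auto simp: span_iso_def span_mor_def is_span_def apex_def)
  have "left P = left P' \<cdot> i" "right P = right P' \<cdot> i"
    using i unfolding span_iso_def span_mor_def by metis+
  then have "left S \<cdot> left P = (left S \<cdot> left P') \<cdot> i" "right Q \<cdot> right P = (right Q \<cdot> right P') \<cdot> i"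
    using SQ ar i' by (metis Comp_assoc)+
  then show ?thesis
    using is_span_span_comp[OF S Q P] is_span_span_comp[OF S Q P'] SQ ar i'
    by (auto simp: span_iso_def span_mor_def span_comp_def apex_def Comp_closed Dom_Comp Cod_Comp)
qed

end

section \<open>Squares that a functor sends to pullbacks\<close>

locale cat_functor = C: category C + C': category C'
  for C :: "('o, 'm) cat" and C' :: "('p, 'n) cat" +
  fixes F :: "('o, 'm, 'p, 'n) fctr"
  assumes functoriality: "is_functor C C' F"
begin

lemma on_ar_closed: "f \<in> Ar C \<Longrightarrow> on_ar F f \<in> Ar C'"
  and Dom_on_ar: "f \<in> Ar C \<Longrightarrow> Dom C' (on_ar F f) = on_ob F (Dom C f)"
  and Cod_on_ar: "f \<in> Ar C \<Longrightarrow> Cod C' (on_ar F f) = on_ob F (Cod C f)"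
  and on_ar_Ident: "X \<in> Ob C \<Longrightarrow> on_ar F (Ident C X) = Ident C' (on_ob F X)"
  and on_ar_Comp: "\<lbrakk>f \<in> Ar C; g \<in> Ar C; Cod C f = Dom C g\<rbrakk> \<Longrightarrow>
    on_ar F (g \<cdot>\<^bsub>C\<^esub> f) = on_ar F g \<cdot>\<^bsub>C'\<^esub> on_ar F f"
  using functoriality by (auto simp: is_functor_def)

lemma is_iso_on_ar:
  assumes "is_iso C f"
  shows "is_iso C' (on_ar F f)"
proof -
  have f: "f \<in> Ar C"
    using assms by (simp add: is_iso_def)
  obtain g where g: "g \<in> Ar C" "Dom C g = Cod C f" "Cod C g = Dom C f"
    "g \<cdot>\<^bsub>C\<^esub> f = Ident C (Dom C f)" "f \<cdot>\<^bsub>C\<^esub> g = Ident C (Cod C f)"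
    using assms by (rule is_isoE)
  have "on_ar F g \<cdot>\<^bsub>C'\<^esub> on_ar F f = Ident C' (on_ob F (Dom C f))"
    "on_ar F f \<cdot>\<^bsub>C'\<^esub> on_ar F g = Ident C' (on_ob F (Cod C f))"
    using f g by (metis on_ar_Comp on_ar_Ident C.Dom_closed C.Cod_closed)+
  then show ?thesis
    unfolding is_iso_def using f g
    by (auto simp: on_ar_closed Dom_on_ar Cod_on_ar intro!: bexI[of _ "on_ar F g"])
qed

lemma is_F_pullback_Span_iff:
  "is_F_pullback C C' F (Span a b) (Cospan f g) \<longleftrightarrow> paired C (Span a b) (Cospan f g) \<and>
    is_pullback C' (Span (on_ar F a) (on_ar F b)) (Cospan (on_ar F f) (on_ar F g))"
  by (simp add: is_F_pullback_def fspan_def fcospan_def)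

lemma F_pullback_swap:
  "is_F_pullback C C' F (Span a b) (Cospan f g) \<Longrightarrow> is_F_pullback C C' F (Span b a) (Cospan g f)"
  by (simp add: is_F_pullback_Span_iff paired_swap C'.pullback_swap)

lemma F_pullback_Ident:
  "f \<in> Ar C \<Longrightarrow>
    is_F_pullback C C' F (Span (Ident C (Dom C f)) f) (Cospan f (Ident C (Cod C f)))"
  using C'.pullback_Ident[of "on_ar F f"]
  by (simp add: is_F_pullback_Span_iff C.paired_Ident on_ar_closed Dom_on_ar Cod_on_ar on_ar_Ident
      C.Dom_closed C.Cod_closed)

lemma F_pullback_pasting:
  assumes 1: "is_F_pullback C C' F (Span u v) (Cospan f g)"
    and 2: "is_F_pullback C C' F (Span a b) (Cospan h u)"
    and cod: "Cod C h = Dom C f"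
  shows "is_F_pullback C C' F (Span a (v \<cdot>\<^bsub>C\<^esub> b)) (Cospan (f \<cdot>\<^bsub>C\<^esub> h) g)"
proof -
  note P = 1[unfolded is_F_pullback_Span_iff] 2[unfolded is_F_pullback_Span_iff]
  have ar: "v \<in> Ar C" "b \<in> Ar C" "Cod C b = Dom C v" "f \<in> Ar C" "h \<in> Ar C"
    using P by (auto simp: paired_Span_iff)
  have "is_pullback C' (Span (on_ar F a) (on_ar F v \<cdot>\<^bsub>C'\<^esub> on_ar F b))
      (Cospan (on_ar F f \<cdot>\<^bsub>C'\<^esub> on_ar F h) (on_ar F g))"
    using P ar cod by (intro C'.pullback_pasting) (auto simp: Dom_on_ar Cod_on_ar)
  then show ?thesis
    using P ar cod C.paired_pasting[of u v f g a b h] by (simp add: is_F_pullback_Span_iff on_ar_Comp)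
qed

lemma F_pullback_transport:
  assumes pb: "is_F_pullback C C' F (Span a b) (Cospan (f \<cdot>\<^bsub>C\<^esub> i) (g \<cdot>\<^bsub>C\<^esub> j))"
    and ar: "f \<in> Ar C" "i \<in> Ar C" "Cod C i = Dom C f" "g \<in> Ar C" "j \<in> Ar C" "Cod C j = Dom C g"
    and iso: "is_iso C i" "is_iso C j"
  shows "is_F_pullback C C' F (Span (i \<cdot>\<^bsub>C\<^esub> a) (j \<cdot>\<^bsub>C\<^esub> b)) (Cospan f g)"
proof -
  have P: "paired C (Span a b) (Cospan (f \<cdot>\<^bsub>C\<^esub> i) (g \<cdot>\<^bsub>C\<^esub> j))"
    using pb by (simp add: is_F_pullback_Span_iff)
  then have ab: "a \<in> Ar C" "b \<in> Ar C" "Cod C a = Dom C i" "Cod C b = Dom C j"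
    using ar by (auto simp: paired_Span_iff C.Dom_Comp)
  have "is_pullback C' (Span (on_ar F i \<cdot>\<^bsub>C'\<^esub> on_ar F a) (on_ar F j \<cdot>\<^bsub>C'\<^esub> on_ar F b))
      (Cospan (on_ar F f) (on_ar F g))"
    using pb ar iso
    by (intro C'.pullback_transport)
      (simp_all add: is_F_pullback_Span_iff on_ar_Comp on_ar_closed Dom_on_ar Cod_on_ar is_iso_on_ar)
  then show ?thesis
    using C.paired_transport[OF P ar] ab ar by (simp add: is_F_pullback_Span_iff on_ar_Comp)
qed

end

section \<open>The span category of a span tight functor\<close>

locale span_tight_functor = cat_functor +
  assumes tight: "span_tight C C' F"
begin

lemma F_pullback_exists:
  assumes "is_span C S" "is_span C Q" "right_foot C S = left_foot C Q"
  obtains P where "is_F_pullback C C' F P (Cospan (right S) (left Q))"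
proof -
  have "is_cospan C (Cospan (right S) (left Q))"
    using assms by (simp add: is_cospan_def is_span_def left_foot_def right_foot_def)
  then show thesis
    using tight that by (auto simp: span_tight_def has_F_pullbacks_def)
qed

lemma F_pullback_unique:
  assumes "is_F_pullback C C' F P K" "is_F_pullback C C' F P' K"
  obtains i where "span_iso C P P' i"
  using tight assms unfolding span_tight_def by blast

text \<open>Transporting \<open>P\<close> along the two given isomorphisms yields an F-pullback for the
  second pair of spans whose composite is literally the old one; only the choice of F-pullback then
  remains to be compared.\<close>

lemma span_comp_well_defined:
  assumes S: "is_span C S" "is_span C S'" "span_class C S = span_class C S'"
    and Q: "is_span C Q" "is_span C Q'" "span_class C Q = span_class C Q'"
    and P: "is_F_pullback C C' F P (Cospan (right S) (left Q))"
    and P': "is_F_pullback C C' F P' (Cospan (right S') (left Q'))"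
  shows "span_class C (span_comp C S P Q) = span_class C (span_comp C S' P' Q')"
proof -
  obtain i where i: "span_iso C S S' i"
    using S C.span_class_eq_iff by auto
  obtain j where j: "span_iso C Q Q' j"
    using Q C.span_class_eq_iff by auto
  note ij = i[unfolded span_iso_def span_mor_def apex_def]
    j[unfolded span_iso_def span_mor_def apex_def]
  obtain a b where ab: "P = Span a b" by (cases P)
  have paired: "paired C P (Cospan (right S) (left Q))" "paired C P' (Cospan (right S') (left Q'))"
    using P P' by (simp_all add: is_F_pullback_def)
  let ?T = "Span (i \<cdot>\<^bsub>C\<^esub> a) (j \<cdot>\<^bsub>C\<^esub> b)"
  have T: "is_F_pullback C C' F ?T (Cospan (right S') (left Q'))"
    using P ij S Q unfolding ab by (intro F_pullback_transport) (auto simp: is_span_def)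
  have SQ': "left S' \<in> Ar C" "right Q' \<in> Ar C"
    using S Q by (auto simp: is_span_def)
  have "a \<in> Ar C" "b \<in> Ar C" "Cod C a = Dom C (left S)" "Cod C b = Dom C (right Q)"
    using paired(1) S Q by (auto simp: ab paired_Span_iff is_span_def)
  then have "(left S' \<cdot>\<^bsub>C\<^esub> i) \<cdot>\<^bsub>C\<^esub> a = left S' \<cdot>\<^bsub>C\<^esub> (i \<cdot>\<^bsub>C\<^esub> a)"
    "(right Q' \<cdot>\<^bsub>C\<^esub> j) \<cdot>\<^bsub>C\<^esub> b = right Q' \<cdot>\<^bsub>C\<^esub> (j \<cdot>\<^bsub>C\<^esub> b)"
    using SQ' ij S Q by (metis C.Comp_assoc is_span_def)+
  then have "span_comp C S P Q = span_comp C S' ?T Q'"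
    using ij unfolding ab span_comp_def by (metis span.sel)
  moreover obtain k where "span_iso C ?T P' k"
    using F_pullback_unique[OF T P'] .
  then have "span_iso C (span_comp C S' ?T Q') (span_comp C S' P' Q') k"
    using T P' S Q by (intro C.span_comp_iso_apex) (auto simp: is_F_pullback_def)
  ultimately show ?thesis
    using C.is_span_span_comp(1)[OF S(1) Q(1) paired(1)] C.is_span_span_comp(1)[OF S(2) Q(2) paired(2)]
    by (auto simp: C.span_class_eq_iff)
qed

lemma Ob_Span_cat: "Ob (Span_cat C C' F) = Ob C"
  and Ident_Span_cat: "Ident (Span_cat C C' F) X = span_class C (Span (Ident C X) (Ident C X))"
  by (simp_all add: Span_cat_def)

lemma Ar_Span_catE:
  assumes "a \<in> Ar (Span_cat C C' F)"
  obtains S where "is_span C S" "a = span_class C S"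
  using assms by (auto simp: Span_cat_def)

lemma Ar_Span_catI: "is_span C S \<Longrightarrow> span_class C S \<in> Ar (Span_cat C C' F)"
  by (auto simp: Span_cat_def)

lemma Dom_Span_cat:
  "is_span C S \<Longrightarrow> Dom (Span_cat C C' F) (span_class C S) = right_foot C S"
  unfolding Span_cat_def by (auto intro!: the_equality dest: C.span_class_eq_feet)

lemma Cod_Span_cat:
  "is_span C S \<Longrightarrow> Cod (Span_cat C C' F) (span_class C S) = left_foot C S"
  unfolding Span_cat_def by (auto intro!: the_equality dest: C.span_class_eq_feet)

lemma Comp_Span_cat:
  assumes S: "is_span C S" and Q: "is_span C Q" and feet: "right_foot C S = left_foot C Q"
    and P: "is_F_pullback C C' F P (Cospan (right S) (left Q))"
  shows "span_class C S \<cdot>\<^bsub>Span_cat C C' F\<^esub> span_class C Q = span_class C (span_comp C S P Q)"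
proof -
  let ?R = "\<lambda>c. \<exists>S' Q' P'. is_span C S' \<and> is_span C Q' \<and>
      span_class C S = span_class C S' \<and> span_class C Q = span_class C Q' \<and>
      right_foot C S' = left_foot C Q' \<and> is_F_pullback C C' F P' (Cospan (right S') (left Q')) \<and>
      c = span_class C (span_comp C S' P' Q')"
  have "(THE c. ?R c) = span_class C (span_comp C S P Q)"
  proof (rule the_equality)
    show "?R (span_class C (span_comp C S P Q))"
      using assms by blast
    show "c = span_class C (span_comp C S P Q)" if "?R c" for c
      using that span_comp_well_defined[OF S _ _ Q _ _ P] by metis
  qed
  then show ?thesis
    by (simp add: Span_cat_def)
qed

lemma is_span_Ident: "X \<in> Ob C \<Longrightarrow> is_span C (Span (Ident C X) (Ident C X))"
  by (simp add: is_span_def C.Ident_closed)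

text \<open>Along an F-square with two identity sides the composite is \<open>S\<close> itself, not merely a span
  isomorphic to it.\<close>

lemma Comp_Ident_right_Span_cat:
  assumes S: "is_span C S"
  shows "span_class C S \<cdot>\<^bsub>Span_cat C C' F\<^esub> Ident (Span_cat C C' F) (right_foot C S) = span_class C S"
proof -
  let ?I = "Span (Ident C (right_foot C S)) (Ident C (right_foot C S))"
  let ?P = "Span (Ident C (apex C S)) (right S)"
  have S': "left S \<in> Ar C" "right S \<in> Ar C" "Dom C (left S) = Dom C (right S)"
    using S by (auto simp: is_span_def)
  have I: "is_span C ?I" "right_foot C S = left_foot C ?I"
    using S' by (auto intro!: is_span_Ident
        simp: right_foot_def left_foot_def C.Cod_closed C.Cod_Ident)
  have "is_F_pullback C C' F ?P (Cospan (right S) (left ?I))"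
    using F_pullback_Ident[of "right S"] S' by (simp add: apex_def right_foot_def)
  from Comp_Span_cat[OF S I this]
  have "span_class C S \<cdot>\<^bsub>Span_cat C C' F\<^esub> span_class C ?I = span_class C (span_comp C S ?P ?I)" .
  moreover have "span_comp C S ?P ?I = S"
    using S' by (cases S) (auto simp: span_comp_def apex_def right_foot_def C.Comp_Ident_left
        C.Comp_Ident_right, metis C.Comp_Ident_right)
  ultimately show ?thesis
    by (simp add: Ident_Span_cat)
qed

lemma Comp_Ident_left_Span_cat:
  assumes S: "is_span C S"
  shows "Ident (Span_cat C C' F) (left_foot C S) \<cdot>\<^bsub>Span_cat C C' F\<^esub> span_class C S = span_class C S"
proof -
  let ?I = "Span (Ident C (left_foot C S)) (Ident C (left_foot C S))"
  let ?P = "Span (left S) (Ident C (apex C S))"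
  have S': "left S \<in> Ar C" "right S \<in> Ar C" "Dom C (left S) = Dom C (right S)"
    using S by (auto simp: is_span_def)
  have I: "is_span C ?I" "right_foot C ?I = left_foot C S"
    using S' by (auto intro!: is_span_Ident
        simp: right_foot_def left_foot_def C.Cod_closed C.Cod_Ident)
  have "is_F_pullback C C' F ?P (Cospan (right ?I) (left S))"
    using F_pullback_swap[OF F_pullback_Ident[of "left S"]] S' by (simp add: apex_def left_foot_def)
  from Comp_Span_cat[OF I(1) S I(2) this]
  have "span_class C ?I \<cdot>\<^bsub>Span_cat C C' F\<^esub> span_class C S = span_class C (span_comp C ?I ?P S)" .
  moreover have "span_comp C ?I ?P S = S"
    using S' by (cases S) (auto simp: span_comp_def apex_def left_foot_def C.Comp_Ident_left
        C.Comp_Ident_right)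
  ultimately show ?thesis
    by (simp add: Ident_Span_cat)
qed

text \<open>With \<open>P1\<close> over the cospan between \<open>S\<close> and \<open>Q\<close>, \<open>P2\<close> over the one between \<open>Q\<close> and \<open>T\<close>, and
  \<open>P = (a, b)\<close> over the one between \<open>P1\<close> and \<open>P2\<close>, pasting \<open>P\<close> onto \<open>P2\<close> gives an F-pullback that
  computes \<open>(S Q) T\<close>, and pasting \<open>P\<close> onto \<open>P1\<close> gives one that computes \<open>S (Q T)\<close>. Both composites
  have the apex of \<open>P\<close>.\<close>

lemma Comp_assoc_Span_cat:
  assumes S: "is_span C S" and Q: "is_span C Q" and T: "is_span C T"
    and SQ: "right_foot C S = left_foot C Q" and QT: "right_foot C Q = left_foot C T"
  shows "(span_class C S \<cdot>\<^bsub>Span_cat C C' F\<^esub> span_class C Q) \<cdot>\<^bsub>Span_cat C C' F\<^esub> span_class C T =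
    span_class C S \<cdot>\<^bsub>Span_cat C C' F\<^esub> (span_class C Q \<cdot>\<^bsub>Span_cat C C' F\<^esub> span_class C T)"
proof -
  obtain P1 where P1: "is_F_pullback C C' F P1 (Cospan (right S) (left Q))"
    using F_pullback_exists[OF S Q SQ] .
  obtain P2 where P2: "is_F_pullback C C' F P2 (Cospan (right Q) (left T))"
    using F_pullback_exists[OF Q T QT] .
  obtain x y where xy: "P1 = Span x y" by (cases P1)
  obtain u v where uv: "P2 = Span u v" by (cases P2)
  have p1: "paired C (Span x y) (Cospan (right S) (left Q))"
    and p2: "paired C (Span u v) (Cospan (right Q) (left T))"
    using P1 P2 by (simp_all add: is_F_pullback_def xy uv)
  note ar = p1[unfolded paired_Span_iff] p2[unfolded paired_Span_iff]
  have spans: "is_span C P1" "is_span C P2" "right_foot C P1 = left_foot C P2"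
    using ar Q by (auto simp: xy uv is_span_def right_foot_def left_foot_def)
  then obtain P where "is_F_pullback C C' F P (Cospan (right P1) (left P2))"
    using F_pullback_exists by blast
  then obtain a b where P: "is_F_pullback C C' F (Span a b) (Cospan y u)"
    by (cases P) (auto simp: xy uv)
  then have p: "paired C (Span a b) (Cospan y u)"
    by (simp add: is_F_pullback_def)
  note ar = ar p[unfolded paired_Span_iff] S[unfolded is_span_def] Q[unfolded is_span_def]
    T[unfolded is_span_def]
  let ?SQ = "span_comp C S P1 Q" and ?QT = "span_comp C Q P2 T"
  let ?L = "Span a (v \<cdot>\<^bsub>C\<^esub> b)" and ?R = "Span (x \<cdot>\<^bsub>C\<^esub> a) b"
  have sSQ: "is_span C ?SQ" "right_foot C ?SQ = left_foot C T"
    using C.is_span_span_comp[OF S Q, of P1] p1 QT by (simp_all add: xy)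
  have sQT: "is_span C ?QT" "right_foot C S = left_foot C ?QT"
    using C.is_span_span_comp[OF Q T, of P2] p2 SQ by (simp_all add: uv)
  have L: "is_F_pullback C C' F ?L (Cospan (right ?SQ) (left T))"
    using F_pullback_pasting[OF P2[unfolded uv] P] ar by (simp add: span_comp_def xy)
  have R: "is_F_pullback C C' F ?R (Cospan (right S) (left ?QT))"
    using F_pullback_swap[OF F_pullback_pasting[OF F_pullback_swap[OF P1[unfolded xy]]
          F_pullback_swap[OF P]]] ar
    by (simp add: span_comp_def uv)
  have "span_comp C ?SQ ?L T = span_comp C S ?R ?QT"
    using ar by (simp add: span_comp_def xy uv C.Comp_assoc)
  then show ?thesis
    using Comp_Span_cat[OF S Q SQ P1] Comp_Span_cat[OF Q T QT P2]
      Comp_Span_cat[OF sSQ(1) T sSQ(2) L] Comp_Span_cat[OF S sQT(1) sQT(2) R]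
    by simp
qed

lemma Comp_Span_cat_span:
  assumes S: "is_span C S" and Q: "is_span C Q" and feet: "right_foot C S = left_foot C Q"
  obtains T where "is_span C T" "left_foot C T = left_foot C S" "right_foot C T = right_foot C Q"
    "span_class C S \<cdot>\<^bsub>Span_cat C C' F\<^esub> span_class C Q = span_class C T"
proof -
  obtain P where P: "is_F_pullback C C' F P (Cospan (right S) (left Q))"
    using F_pullback_exists[OF assms] .
  then have "paired C P (Cospan (right S) (left Q))"
    by (simp add: is_F_pullback_def)
  then show thesis
    using C.is_span_span_comp[OF S Q, of P] Comp_Span_cat[OF assms P] that by blast
qed

lemma category_Span_cat: "category (Span_cat C C' F)"
proof
  let ?D = "Span_cat C C' F"
  have feet_closed: "left_foot C S \<in> Ob C" "right_foot C S \<in> Ob C" if "is_span C S" for S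
    using that by (auto simp: is_span_def left_foot_def right_foot_def C.Cod_closed)
  have comp: "g \<cdot>\<^bsub>?D\<^esub> f \<in> Ar ?D \<and> Dom ?D (g \<cdot>\<^bsub>?D\<^esub> f) = Dom ?D f \<and> Cod ?D (g \<cdot>\<^bsub>?D\<^esub> f) = Cod ?D g"
    if fg: "f \<in> Ar ?D" "g \<in> Ar ?D" "Cod ?D f = Dom ?D g" for f g
  proof -
    obtain Q where Q: "is_span C Q" "f = span_class C Q"
      using fg(1) by (rule Ar_Span_catE)
    obtain S where S: "is_span C S" "g = span_class C S"
      using fg(2) by (rule Ar_Span_catE)
    have "right_foot C S = left_foot C Q"
      using fg(3) Q S by (simp add: Dom_Span_cat Cod_Span_cat)
    then obtain T where "is_span C T" "left_foot C T = left_foot C S"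
      "right_foot C T = right_foot C Q" "g \<cdot>\<^bsub>?D\<^esub> f = span_class C T"
      using Comp_Span_cat_span[OF S(1) Q(1)] S(2) Q(2) by metis
    then show ?thesis
      using S Q by (simp add: Dom_Span_cat Cod_Span_cat Ar_Span_catI)
  qed
  fix f g h X
  show "g \<cdot>\<^bsub>?D\<^esub> f \<in> Ar ?D" "Dom ?D (g \<cdot>\<^bsub>?D\<^esub> f) = Dom ?D f" "Cod ?D (g \<cdot>\<^bsub>?D\<^esub> f) = Cod ?D g"
    if "f \<in> Ar ?D" "g \<in> Ar ?D" "Cod ?D f = Dom ?D g"
    using comp[OF that] by auto
  show "Dom ?D f \<in> Ob ?D" "Cod ?D f \<in> Ob ?D" "f \<cdot>\<^bsub>?D\<^esub> Ident ?D (Dom ?D f) = f"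
    "Ident ?D (Cod ?D f) \<cdot>\<^bsub>?D\<^esub> f = f" if "f \<in> Ar ?D"
    using that feet_closed Comp_Ident_right_Span_cat Comp_Ident_left_Span_cat
    by (auto elim!: Ar_Span_catE simp: Ob_Span_cat Dom_Span_cat Cod_Span_cat)
  show "Ident ?D X \<in> Ar ?D" "Dom ?D (Ident ?D X) = X" "Cod ?D (Ident ?D X) = X" if "X \<in> Ob ?D"
    using that is_span_Ident[of X]
    by (simp_all add: Ob_Span_cat Ident_Span_cat Ar_Span_catI Dom_Span_cat Cod_Span_cat
        left_foot_def right_foot_def C.Cod_Ident)
  show "(h \<cdot>\<^bsub>?D\<^esub> g) \<cdot>\<^bsub>?D\<^esub> f = h \<cdot>\<^bsub>?D\<^esub> (g \<cdot>\<^bsub>?D\<^esub> f)"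
    if "f \<in> Ar ?D" "g \<in> Ar ?D" "h \<in> Ar ?D" "Cod ?D f = Dom ?D g" "Cod ?D g = Dom ?D h"
    using that by (auto elim!: Ar_Span_catE simp: Dom_Span_cat Cod_Span_cat Comp_assoc_Span_cat)
qed

end

theorem theorem5p1:
  fixes C :: "('o, 'm) cat" and C' :: "('p, 'n) cat" and F :: "('o, 'm, 'p, 'n) fctr"
  assumes "category C" and "category C'" and "is_functor C C' F"
    and "span_tight C C' F"
  shows "category (Span_cat C C' F) \<and>
    (\<forall>S. is_span C S \<longrightarrow>
      Dom (Span_cat C C' F) (span_class C S) = right_foot C S \<and>
      Cod (Span_cat C C' F) (span_class C S) = left_foot C S) \<and>
    (\<forall>S Q. is_span C S \<and> is_span C Q \<and> right_foot C S = left_foot C Q \<longrightarrow>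
      (\<exists>P. is_F_pullback C C' F P (Cospan (right S) (left Q)))) \<and>
    (\<forall>S Q P S' Q' P'.
      is_span C S \<and> is_span C Q \<and> right_foot C S = left_foot C Q \<and>
      is_span C S' \<and> is_span C Q' \<and> right_foot C S' = left_foot C Q' \<and>
      span_class C S = span_class C S' \<and> span_class C Q = span_class C Q' \<and>
      is_F_pullback C C' F P (Cospan (right S) (left Q)) \<and>
      is_F_pullback C C' F P' (Cospan (right S') (left Q')) \<longrightarrow>
      span_class C (span_comp C S P Q) = span_class C (span_comp C S' P' Q')) \<and>
    (\<forall>S Q P.
      is_span C S \<and> is_span C Q \<and> right_foot C S = left_foot C Q \<and>
      is_F_pullback C C' F P (Cospan (right S) (left Q)) \<longrightarrow>
      span_class C S \<cdot>\<^bsub>Span_cat C C' F\<^esub> span_class C Q = span_class C (span_comp C S P Q))"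
proof -
  interpret span_tight_functor C C' F
    using assms
    by (simp add: span_tight_functor_def cat_functor_def span_tight_functor_axioms_def
        cat_functor_axioms_def)
  show ?thesis
  proof (intro conjI allI impI; (elim conjE)?)
    show "category (Span_cat C C' F)"
      by (rule category_Span_cat)
  qed ((rule Dom_Span_cat Cod_Span_cat Comp_Span_cat span_comp_well_defined; assumption) |
      (erule (2) F_pullback_exists, blast))+
qed

end
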